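(* Let $d>1$ be an integer, let $\mu$ be a probability measure on $\mathbb{R}^d$, let $X\sim\mu$, and let $\mathcal{Q}_{\mathrm{HF}},\mathcal{Q}_{\mathrm{LF}}\colon\mathbb{R}^d\to\mathbb{R}$ be measurable functions such that $\mathcal{Q}_{\mathrm{HF}}(X)$ and $\mathcal{Q}_{\mathrm{LF}}(X)$ have finite second moments. Let $$\mathcal{F}_{\mathrm{HF}}(t)=\mathbb{P}^\mu(\mathcal{Q}_{\mathrm{HF}}(X)\le t),\qquad \mathcal{F}_{\mathrm{LF}}(t)=\mathbb{P}^\mu(\mathcal{Q}_{\mathrm{LF}}(X)\le t),\qquad t\in\mathbb{R},$$ be their cumulative distribution functions, and assume that both $\mathcal{F}_{\mathrm{HF}}$ and $\mathcal{F}_{\mathrm{LF}}$ are invertible. Define the modified low-fidelity model $$\widetilde{\mathcal{Q}}_{\mathrm{LF}}(x)=\mathcal{F}_{\mathrm{LF}}^{-1}\left(\mathcal{F}_{\mathrm{HF}}(\mathcal{Q}_{\mathrm{HF}}(x))\right),$$ and the Pearson correlation coefficients $$\rho=\frac{\operatorname{Cov}^\mu(\mathcal{Q}_{\mathrm{HF}}(X),\mathcal{Q}_{\mathrm{LF}}(X))}{\sqrt{\operatorname{Var}^\mu[\mathcal{Q}_{\mathrm{HF}}(X)]\operatorname{Var}^\mu[\mathcal{Q}_{\mathrm{LF}}(X)]}},\qquad \widetilde\rho=\frac{\operatorname{Cov}^\mu(\mathcal{Q}_{\mathrm{HF}}(X),\widetilde{\mathcal{Q}}_{\mathrm{LF}}(X))}{\sqrt{\operatorname{Var}^\mu[\mathcal{Q}_{\mathrm{HF}}(X)]\operatorname{Var}^\mu[\widetilde{\mathcal{Q}}_{\mathrm{LF}}(X)]}}.$$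 Then $$\widetilde\rho\ge\rho.$$
   Context: The superscript $\mu$ on $\mathbb{P}$, $\operatorname{Cov}$ and $\operatorname{Var}$ means that they are computed with respect to $X\sim\mu$. A cumulative distribution function $\mathcal{F}$ is called invertible if it restricts to a bijection from $\{t\in\mathbb{R}\colon 0<\mathcal{F}(t)<1\}$ onto $(0,1)$; its inverse $\mathcal{F}^{-1}\colon(0,1)\to\mathbb{R}$ then coincides with the generalized inverse $\mathcal{F}^{-1}(u)=\inf\{t\in\mathbb{R}\colon\mathcal{F}(t)\ge u\}$. The function $\widetilde{\mathcal{Q}}_{\mathrm{LF}}$ is thereby defined at every $x$ with $0<\mathcal{F}_{\mathrm{HF}}(\mathcal{Q}_{\mathrm{HF}}(x))<1$, which is $\mu$-almost every $x$; on the remaining $\mu$-null set it may be given an arbitrary value (e.g. $0$). *)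

theory Defs
  imports "HOL-Probability.Probability"
begin

definition invertibility_set :: "(real \<Rightarrow> real) \<Rightarrow> real set" where
  "invertibility_set F = {t. 0 < F t \<and> F t < 1}"

definition invertible_cdf :: "(real \<Rightarrow> real) \<Rightarrow> bool" where
  "invertible_cdf F \<longleftrightarrow> bij_betw F (invertibility_set F) {0<..<1}"

(* Meaningful only for invertible F and at arguments in the open interval (0,1). *)
definition cdf_inverse :: "(real \<Rightarrow> real) \<Rightarrow> real \<Rightarrow> real" where
  "cdf_inverse F = the_inv_into (invertibility_set F) F"

(* c is the value at the points where the inverse of F_LF cannot be applied;
   if F_HF is the (invertible) distribution function of Q_HF, these form a null set. *)
definition modified_model ::
  "real \<Rightarrow> (real \<Rightarrow> real) \<Rightarrow> (real \<Rightarrow> real) \<Rightarrow> ('a \<Rightarrow> real) \<Rightarrow> 'a \<Rightarrow> real" where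
  "modified_model c F_HF F_LF Q_HF x =
     (if 0 < F_HF (Q_HF x) \<and> F_HF (Q_HF x) < 1
      then cdf_inverse F_LF (F_HF (Q_HF x)) else c)"

definition covariance :: "'a measure \<Rightarrow> ('a \<Rightarrow> real) \<Rightarrow> ('a \<Rightarrow> real) \<Rightarrow> real" where
  "covariance M Y Z =
     prob_space.expectation M
       (\<lambda>\<omega>. (Y \<omega> - prob_space.expectation M Y) * (Z \<omega> - prob_space.expectation M Z))"

definition pearson_correlation :: "'a measure \<Rightarrow> ('a \<Rightarrow> real) \<Rightarrow> ('a \<Rightarrow> real) \<Rightarrow> real" where
  "pearson_correlation M Y Z =
     covariance M Y Z / sqrt (prob_space.variance M Y * prob_space.variance M Z)"

end

theory Submission
  imports Defs
begin

text \<open>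
  Write $Y$, $Z$, $W$ for the high-fidelity, low-fidelity and modified low-fidelity variables. Since
  $F_{HF}(Y)$ is uniform on $(0,1)$, $W$ has the same law as $Z$, so only $E[Y (W - Z)] \<ge> 0$ is at
  stake. By the layer-cake formula for $Y$ this reduces to $E[1_{Y > s} (W - Z)] \<ge> 0$ for all $s$.
  As $W$ is an increasing function of $Y$, the event $Y > s$ is $W > t$ for some $t$, and then
  $E[1_{Y > s} (Z - t)] \<le> E[(Z - t)^+] = E[(W - t)^+] = E[1_{Y > s} (W - t)]$.
\<close>

section \<open>Layer-cake reduction to upper tails\<close>

text \<open>With \<open>Y\<close> truncated to [-K, K], the number
  \<open>clamp K (Y \<omega>) + K\<close> is the integral over s in [-K, K) of the indicator of Y >
  s. Multiplying by \<open>D\<close> and exchanging integrals writes the expectation as an integral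
  of the nonnegative tail terms. The truncation is then removed by dominated convergence.\<close>

lemma expectation_mult_nonneg:
  fixes Y D :: "'a \<Rightarrow> real"
  assumes "prob_space M" and [measurable]: "Y \<in> borel_measurable M"
    and D: "integrable M D" and YD: "integrable M (\<lambda>\<omega>. Y \<omega> * D \<omega>)"
    and mean: "(\<integral>\<omega>. D \<omega> \<partial>M) = 0"
    and tail: "\<And>s. 0 \<le> (\<integral>\<omega>. indicator {s<..} (Y \<omega>) * D \<omega> \<partial>M)"
  shows "0 \<le> (\<integral>\<omega>. Y \<omega> * D \<omega> \<partial>M)"
proof -
  interpret prob_space M by fact
  interpret P: pair_sigma_finite M lborel ..
  have [measurable]: "D \<in> borel_measurable M" using D by auto
  \<comment> \<open>Truncating keeps s in a bounded interval, so that integrability of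
    \<open>D\<close> alone justifies Fubini.\<close>
  define clamp where "clamp K y = max (-K) (min K y)" for K y :: real
  have [measurable]: "clamp K \<in> borel_measurable borel" for K
    unfolding clamp_def by measurable
  have trunc: "0 \<le> (\<integral>\<omega>. clamp K (Y \<omega>) * D \<omega> \<partial>M)" if K: "K \<ge> 0" for K
  proof -
    let ?f = "\<lambda>\<omega> s. indicator {-K..<K} s * (indicator {s<..} (Y \<omega>) * D \<omega>)"
    have layer: "(\<integral>s. ?f \<omega> s \<partial>lborel) = (clamp K (Y \<omega>) + K) * D \<omega>" for \<omega>
    proof -
      \<comment> \<open>For s in [-K, K), the conditions s < y and s < \<open>clamp K y\<close> are
        equivalent.\<close>
      have "(\<integral>s. ?f \<omega> s \<partial>lborel) = (\<integral>s. indicator {-K..<clamp K (Y \<omega>)} s * D \<omega> \<partial>lborel)"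
        using K by (intro Bochner_Integration.integral_cong) (auto simp: clamp_def indicator_def)
      also have "\<dots> = (clamp K (Y \<omega>) + K) * D \<omega>"
        using K by (simp add: clamp_def)
      finally show ?thesis .
    qed
    have meas: "case_prod ?f \<in> borel_measurable (M \<Otimes>\<^sub>M lborel)"
      by (simp add: indicator_def case_prod_beta) measurable
    have sec: "integrable lborel (?f \<omega>)" for \<omega>
    proof (rule Bochner_Integration.integrable_bound)
      show "integrable lborel (\<lambda>s. indicator {-K..<K} s * D \<omega>)"
        using K by (intro integrable_mult_left integrable_real_indicator) auto
    qed (auto simp: indicator_def)
    have "integrable M (\<lambda>\<omega>. \<integral>s. norm (?f \<omega> s) \<partial>lborel)"
    proof -
      have "(\<integral>s. norm (?f \<omega> s) \<partial>lborel) = (clamp K (Y \<omega>) + K) * \<bar>D \<omega>\<bar>" for \<omega>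
      proof -
        have "(\<integral>s. norm (?f \<omega> s) \<partial>lborel) = (\<integral>s. indicator {-K..<clamp K (Y \<omega>)} s * \<bar>D \<omega>\<bar> \<partial>lborel)"
          using K by (intro Bochner_Integration.integral_cong) (auto simp: clamp_def indicator_def)
        also have "\<dots> = (clamp K (Y \<omega>) + K) * \<bar>D \<omega>\<bar>"
          using K by (simp add: clamp_def)
        finally show ?thesis .
      qed
      moreover have "integrable M (\<lambda>\<omega>. (clamp K (Y \<omega>) + K) * \<bar>D \<omega>\<bar>)"
      proof (rule Bochner_Integration.integrable_bound)
        show "integrable M (\<lambda>\<omega>. 2 * K * D \<omega>)" using D by simp
        show "AE \<omega> in M. norm ((clamp K (Y \<omega>) + K) * \<bar>D \<omega>\<bar>) \<le> norm (2 * K * D \<omega>)"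
          using K by (auto simp: clamp_def abs_mult intro!: mult_right_mono)
      qed measurable
      ultimately show ?thesis by simp
    qed
    then have int: "integrable (M \<Otimes>\<^sub>M lborel) (case_prod ?f)"
      using meas sec by (intro P.Fubini_integrable) auto
    have "0 \<le> (\<integral>s. (\<integral>\<omega>. ?f \<omega> s \<partial>M) \<partial>lborel)"
      unfolding integral_mult_right_zero
      by (intro Bochner_Integration.integral_nonneg mult_nonneg_nonneg[OF _ tail]) simp
    also have "\<dots> = (\<integral>\<omega>. (\<integral>s. ?f \<omega> s \<partial>lborel) \<partial>M)"
      by (rule P.Fubini_integral[OF int])
    also have "\<dots> = (\<integral>\<omega>. clamp K (Y \<omega>) * D \<omega> + K * D \<omega> \<partial>M)"
      unfolding layer by (simp add: algebra_simps)
    \<comment> \<open>The offset K from the lower end of the interval disappears because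
      \<open>D\<close> has mean zero.\<close>
    also have "\<dots> = (\<integral>\<omega>. clamp K (Y \<omega>) * D \<omega> \<partial>M)"
    proof -
      have "integrable M (\<lambda>\<omega>. clamp K (Y \<omega>) * D \<omega>)"
      proof (rule Bochner_Integration.integrable_bound)
        show "integrable M (\<lambda>\<omega>. K * D \<omega>)" using D by simp
        show "AE \<omega> in M. norm (clamp K (Y \<omega>) * D \<omega>) \<le> norm (K * D \<omega>)"
          using K by (auto simp: clamp_def abs_mult intro!: mult_right_mono)
      qed measurable
      then show ?thesis using D mean by simp
    qed
    finally show ?thesis .
  qed
  have "(\<lambda>n. \<integral>\<omega>. clamp (real n) (Y \<omega>) * D \<omega> \<partial>M) \<longlonglongrightarrow> (\<integral>\<omega>. Y \<omega> * D \<omega> \<partial>M)"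
  proof (rule integral_dominated_convergence)
    show "integrable M (\<lambda>\<omega>. \<bar>Y \<omega> * D \<omega>\<bar>)" using YD by simp
    \<comment> \<open>At each point the sequence is constant once n exceeds \<bar>Y\<bar>.\<close>
    show "AE \<omega> in M. (\<lambda>n. clamp (real n) (Y \<omega>) * D \<omega>) \<longlonglongrightarrow> Y \<omega> * D \<omega>"
    proof (intro AE_I2 tendsto_eventually)
      fix \<omega>
      obtain N :: nat where "\<bar>Y \<omega>\<bar> \<le> real N" using real_arch_simple by blast
      then have "clamp (real n) (Y \<omega>) = Y \<omega>" if "n \<ge> N" for n
        using that by (auto simp: clamp_def)
      then show "\<forall>\<^sub>F n in sequentially. clamp (real n) (Y \<omega>) * D \<omega> = Y \<omega> * D \<omega>"
        unfolding eventually_sequentially by auto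
    qed
    show "AE \<omega> in M. norm (clamp (real n) (Y \<omega>) * D \<omega>) \<le> \<bar>Y \<omega> * D \<omega>\<bar>" for n
      by (auto simp: clamp_def abs_mult intro!: mult_right_mono)
  qed measurable
  then show ?thesis
    by (rule LIMSEQ_le_const) (intro exI allI impI trunc of_nat_0_le_iff)
qed

section \<open>Invertible distribution functions and the probability integral transform\<close>

lemma cdf_cdf_inverse:
  assumes "invertible_cdf F" and "0 < u" "u < 1"
  shows "F (cdf_inverse F u) = u"
  using assms unfolding invertible_cdf_def cdf_inverse_def
  by (intro f_the_inv_into_f_bij_betw) auto

text \<open>Injectivity makes monotonicity strict at \<open>y\<close>. Only \<open>F y\<close> has
  to lie in (0,1): if \<open>F x = F y\<close>, then \<open>x\<close> lies in the invertibility set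
  as well.\<close>

lemma invertible_cdf_le_iff:
  assumes "mono F" and "invertible_cdf F" and "0 < F y" "F y < 1"
  shows "F x \<le> F y \<longleftrightarrow> x \<le> y" and "F y \<le> F x \<longleftrightarrow> y \<le> x"
proof -
  have "x = y" if "F x = F y"
    using assms that unfolding invertible_cdf_def bij_betw_def invertibility_set_def
    by (auto dest: inj_onD)
  then show "F x \<le> F y \<longleftrightarrow> x \<le> y" "F y \<le> F x \<longleftrightarrow> y \<le> x"
    using monoD[OF assms(1), of x y] monoD[OF assms(1), of y x]
    by (cases x y rule: linorder_cases; force)+
qed

text \<open>The Galois connection between \<open>F\<close> and its inverse. It covers every real
  \<open>t\<close>, including those where \<open>F t\<close> is 0 or 1.\<close>

lemma cdf_inverse_le_iff:
  assumes "mono F" and "invertible_cdf F" and "0 < u" "u < 1"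
  shows "cdf_inverse F u \<le> t \<longleftrightarrow> u \<le> F t"
  using invertible_cdf_le_iff(2)[OF assms(1,2), of "cdf_inverse F u" t]
    cdf_cdf_inverse[OF assms(2-)] assms(3,4) by simp

locale invertible_variable = prob_space M for M :: "'a measure" +
  fixes Y :: "'a \<Rightarrow> real" and F :: "real \<Rightarrow> real"
  assumes Y [measurable]: "Y \<in> borel_measurable M"
    and F: "F = cdf (distr M borel Y)" and inv: "invertible_cdf F"
begin

lemma F_eq: "F t = prob {\<omega> \<in> space M. Y \<omega> \<le> t}"
  unfolding F cdf_def by (subst measure_distr) (auto intro!: arg_cong[where f=prob])

lemma mono_F: "mono F"
  unfolding F_eq by (intro monoI finite_measure_mono) auto

lemma F_measurable [measurable]: "F \<in> borel_measurable borel"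
  by (rule borel_measurable_mono[OF mono_F])

lemma F_bounds: "0 \<le> F t" "F t \<le> 1"
  by (auto simp: F_eq)

text \<open>Uniformity of F(Y): for u inside (0,1) the event F(Y) \<le> u is Y \<le> y with F(y) =
  u, and its probability is F(y). The endpoints are included because the lemma is later applied at u
  = G(t), which may be 0 or 1.\<close>

lemma prob_F_le:
  assumes "0 \<le> u" "u \<le> 1"
  shows "prob {\<omega> \<in> space M. F (Y \<omega>) \<le> u} = u"
proof -
  have inner: "prob {\<omega> \<in> space M. F (Y \<omega>) \<le> u} = u" if "0 < u" "u < 1" for u
  proof -
    let ?y = "cdf_inverse F u"
    have "F ?y = u" using that by (rule cdf_cdf_inverse[OF inv])
    moreover from this have "F x \<le> u \<longleftrightarrow> x \<le> ?y" for x
      using invertible_cdf_le_iff(1)[OF mono_F inv, of ?y x] that by simp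
    ultimately show ?thesis by (simp flip: F_eq)
  qed
  consider "u = 0" | "0 < u" "u < 1" | "u = 1" using assms by linarith
  then show ?thesis
  proof cases
    case 1
    have "prob {\<omega> \<in> space M. F (Y \<omega>) \<le> 0} \<le> 0"
    proof (rule field_le_epsilon)
      fix e :: real assume "0 < e"
      \<comment> \<open>The minimum with 1/2 keeps the level inside (0,1), where
        \<open>inner\<close> applies.\<close>
      have "prob {\<omega> \<in> space M. F (Y \<omega>) \<le> 0} \<le> prob {\<omega> \<in> space M. F (Y \<omega>) \<le> min e (1/2)}"
        using \<open>0 < e\<close> by (intro finite_measure_mono) auto
      also have "\<dots> = min e (1/2)" using \<open>0 < e\<close> by (intro inner) auto
      finally show "prob {\<omega> \<in> space M. F (Y \<omega>) \<le> 0} \<le> 0 + e" by simp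
    qed
    with 1 show ?thesis by (simp add: measure_le_0_iff)
  next
    case 2 then show ?thesis by (rule inner)
  next
    case 3 then show ?thesis by (simp add: F_bounds prob_space)
  qed
qed

text \<open>Uniformity excludes the values 0 and 1 almost surely, so the default value of the
  modified model does not affect its law.\<close>

lemma AE_F_interior: "AE \<omega> in M. 0 < F (Y \<omega>) \<and> F (Y \<omega>) < 1"
proof -
  have "1 \<le> prob {\<omega> \<in> space M. F (Y \<omega>) < 1}"
  proof (rule field_le_epsilon)
    fix e :: real assume "0 < e"
    have "max (1 - e) 0 = prob {\<omega> \<in> space M. F (Y \<omega>) \<le> max (1 - e) 0}"
      using \<open>0 < e\<close> by (intro prob_F_le[symmetric]) auto
    also have "\<dots> \<le> prob {\<omega> \<in> space M. F (Y \<omega>) < 1}"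
      using \<open>0 < e\<close> by (intro finite_measure_mono) auto
    finally show "1 \<le> prob {\<omega> \<in> space M. F (Y \<omega>) < 1} + e" by simp
  qed
  then have "prob {\<omega> \<in> space M. F (Y \<omega>) < 1} = 1"
    by (intro antisym) auto
  then have 1: "AE \<omega> in M. F (Y \<omega>) < 1"
    by (subst (asm) prob_Collect_eq_1) auto
  have "prob {\<omega> \<in> space M. F (Y \<omega>) \<le> 0} = 0" by (rule prob_F_le) auto
  then have "AE \<omega> in M. \<not> F (Y \<omega>) \<le> 0"
    by (subst (asm) prob_Collect_eq_0) auto
  with 1 show ?thesis by eventually_elim auto
qed

end

section \<open>The modified model has the low-fidelity law and dominates on upper tails of Y\<close>

locale transported_variable =
  HF: invertible_variable M Y F + LF: invertible_variable M Z G
  for M :: "'a measure" and Y Z F G +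
  fixes W :: "'a \<Rightarrow> real" and c :: real
  assumes W: "W = (\<lambda>\<omega>. if 0 < F (Y \<omega>) \<and> F (Y \<omega>) < 1 then cdf_inverse G (F (Y \<omega>)) else c)"
begin

text \<open>Describes the sublevel sets of \<open>W\<close> through \<open>F\<close> and
  \<open>G\<close> only, so measurability of \<open>W\<close> follows without studying
  \<open>cdf_inverse\<close>, which is unspecified outside (0,1).\<close>

lemma W_le_iff:
  "W \<omega> \<le> t \<longleftrightarrow> (if 0 < F (Y \<omega>) \<and> F (Y \<omega>) < 1 then F (Y \<omega>) \<le> G t else c \<le> t)"
  unfolding W using cdf_inverse_le_iff[OF LF.mono_F LF.inv] by auto

lemma W_measurable [measurable]: "W \<in> borel_measurable M"
  unfolding borel_measurable_iff_le W_le_iff by measurable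

text \<open>Up to a null set, W \<le> t means F(Y) \<le> G(t), which has probability G(t) by
  uniformity. Equal distribution functions give equal laws.\<close>

lemma distr_W: "distr M borel W = distr M borel Z"
proof (rule cdf_unique)
  show "real_distribution (distr M borel W)" "real_distribution (distr M borel Z)"
    by (simp_all add: HF.real_distribution_distr)
  show "cdf (distr M borel W) = cdf (distr M borel Z)"
  proof
    fix t
    have "cdf (distr M borel W) t = HF.prob {\<omega> \<in> space M. W \<omega> \<le> t}"
      unfolding cdf_def by (subst measure_distr) (auto intro!: arg_cong[where f=HF.prob])
    also have "\<dots> = HF.prob {\<omega> \<in> space M. F (Y \<omega>) \<le> G t}"
      using HF.AE_F_interior
      by (intro HF.finite_measure_eq_AE) (auto simp: W_le_iff)
    also have "\<dots> = G t" by (intro HF.prob_F_le LF.F_bounds)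
    finally show "cdf (distr M borel W) t = cdf (distr M borel Z) t" by (simp add: LF.F)
  qed
qed

lemma integral_W:
  assumes [measurable]: "h \<in> borel_measurable borel"
  shows "(\<integral>\<omega>. h (W \<omega>) \<partial>M) = (\<integral>\<omega>. h (Z \<omega>) \<partial>M :: real)"
  using arg_cong[OF distr_W, where f="\<lambda>N. integral\<^sup>L N h"] by (simp add: integral_distr)

lemma integrable_W:
  fixes h :: "real \<Rightarrow> real"
  assumes [measurable]: "h \<in> borel_measurable borel"
  shows "integrable M (\<lambda>\<omega>. h (W \<omega>)) \<longleftrightarrow> integrable M (\<lambda>\<omega>. h (Z \<omega>))"
  using arg_cong[OF distr_W, where f="\<lambda>N. integrable N h"] by (simp add: integrable_distr_eq)

text \<open>If F(s) is 0 or 1, the event Y > s has probability one or zero and the integral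
  vanishes. Otherwise Y > s is almost surely an upper level set of \<open>W\<close>, and the
  comparison goes through positive parts.\<close>

lemma tail_nonneg:
  assumes Z: "integrable M Z"
  shows "0 \<le> (\<integral>\<omega>. indicator {s<..} (Y \<omega>) * (W \<omega> - Z \<omega>) \<partial>M)"
proof -
  have W': "integrable M W" using integrable_W[of "\<lambda>x. x"] Z by simp
  have eqE: "(\<integral>\<omega>. W \<omega> \<partial>M) = (\<integral>\<omega>. Z \<omega> \<partial>M)" using integral_W[of "\<lambda>x. x"] by simp
  consider "F s \<le> 0" | "0 < F s" "F s < 1" | "F s = 1" using HF.F_bounds[of s] by linarith
  then show ?thesis
  proof cases
    case 1
    have "AE \<omega> in M. indicator {s<..} (Y \<omega>) * (W \<omega> - Z \<omega>) = W \<omega> - Z \<omega>"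
      using HF.AE_F_interior
    proof eventually_elim
      case (elim \<omega>)
      then have "s < Y \<omega>" using 1 monoD[OF HF.mono_F, of "Y \<omega>" s] by (meson not_le order.trans)
      then show ?case by simp
    qed
    then have "(\<integral>\<omega>. indicator {s<..} (Y \<omega>) * (W \<omega> - Z \<omega>) \<partial>M) = (\<integral>\<omega>. W \<omega> - Z \<omega> \<partial>M)"
      by (intro integral_cong_AE) auto
    then show ?thesis using W' Z eqE by simp
  next
    case 3
    have "AE \<omega> in M. indicator {s<..} (Y \<omega>) * (W \<omega> - Z \<omega>) = 0"
      using HF.AE_F_interior
    proof eventually_elim
      case (elim \<omega>)
      then have "\<not> s < Y \<omega>" using 3 monoD[OF HF.mono_F, of s "Y \<omega>"] by auto
      then show ?case by simp
    qed
    then have "(\<integral>\<omega>. indicator {s<..} (Y \<omega>) * (W \<omega> - Z \<omega>) \<partial>M) = (\<integral>\<omega>. 0 \<partial>M)"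
      by (intro integral_cong_AE) auto
    then show ?thesis by simp
  next
    case 2
    \<comment> \<open>The threshold is chosen with G(t) = F(s), so that W > t and Y > s agree almost
      surely.\<close>
    define t where "t = cdf_inverse G (F s)"
    have Gt: "G t = F s" unfolding t_def by (rule cdf_cdf_inverse[OF LF.inv 2])
    let ?I = "\<lambda>\<omega>. indicator {s<..} (Y \<omega>) :: real"
    have I: "integrable M (\<lambda>\<omega>. ?I \<omega> * (V \<omega> - t))" if V: "integrable M V" for V
    proof (rule Bochner_Integration.integrable_bound)
      show "integrable M (\<lambda>\<omega>. V \<omega> - t)" using V by simp
      show "(\<lambda>\<omega>. ?I \<omega> * (V \<omega> - t)) \<in> borel_measurable M"
        using borel_measurable_integrable[OF V] by measurable
    qed (auto simp: indicator_def)
    \<comment> \<open>The indicator selects exactly the points where W - t is positive.\<close>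
    have "AE \<omega> in M. ?I \<omega> * (W \<omega> - t) = max 0 (W \<omega> - t)"
      using HF.AE_F_interior
    proof eventually_elim
      case (elim \<omega>)
      have "W \<omega> \<le> t \<longleftrightarrow> F (Y \<omega>) \<le> F s" using elim by (simp add: W_le_iff Gt)
      also have "\<dots> \<longleftrightarrow> Y \<omega> \<le> s" by (rule invertible_cdf_le_iff(1)[OF HF.mono_F HF.inv 2])
      finally show ?case by (auto simp: indicator_def)
    qed
    then have "(\<integral>\<omega>. ?I \<omega> * (W \<omega> - t) \<partial>M) = (\<integral>\<omega>. max 0 (W \<omega> - t) \<partial>M)"
      by (intro integral_cong_AE) auto
    also have "\<dots> = (\<integral>\<omega>. max 0 (Z \<omega> - t) \<partial>M)"
      by (rule integral_W[of "\<lambda>x. max 0 (x - t)"]) measurable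
    \<comment> \<open>For any event, its indicator times Z - t is at most the positive part of Z -
      t.\<close>
    also have "\<dots> \<ge> (\<integral>\<omega>. ?I \<omega> * (Z \<omega> - t) \<partial>M)"
      using Z I[OF Z] by (intro integral_mono) (auto simp: indicator_def)
    finally have "(\<integral>\<omega>. ?I \<omega> * (Z \<omega> - t) \<partial>M) \<le> (\<integral>\<omega>. ?I \<omega> * (W \<omega> - t) \<partial>M)" .
    then have "0 \<le> (\<integral>\<omega>. ?I \<omega> * (W \<omega> - t) - ?I \<omega> * (Z \<omega> - t) \<partial>M)"
      using I[OF Z] I[OF W'] by simp
    then show ?thesis by (simp add: algebra_simps)
  qed
qed

end

section \<open>Comparison of covariances and correlations\<close>

text \<open>Domination by the sum of squares, since 2\<bar>yz\<bar> \<le> y^2 + z^2.\<close>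

lemma (in prob_space) integrable_mult_of_square:
  fixes Y Z :: "'a \<Rightarrow> real"
  assumes [measurable]: "Y \<in> borel_measurable M" "Z \<in> borel_measurable M"
    and sq: "integrable M (\<lambda>\<omega>. (Y \<omega>)\<^sup>2)" "integrable M (\<lambda>\<omega>. (Z \<omega>)\<^sup>2)"
  shows "integrable M (\<lambda>\<omega>. Y \<omega> * Z \<omega>)"
proof (rule Bochner_Integration.integrable_bound)
  show "integrable M (\<lambda>\<omega>. (Y \<omega>)\<^sup>2 + (Z \<omega>)\<^sup>2)" using sq by simp
  show "AE \<omega> in M. norm (Y \<omega> * Z \<omega>) \<le> norm ((Y \<omega>)\<^sup>2 + (Z \<omega>)\<^sup>2)"
  proof (rule AE_I2)
    fix \<omega>
    show "norm (Y \<omega> * Z \<omega>) \<le> norm ((Y \<omega>)\<^sup>2 + (Z \<omega>)\<^sup>2)"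
      using sum_squares_bound[of "\<bar>Y \<omega>\<bar>" "\<bar>Z \<omega>\<bar>"]
        mult_nonneg_nonneg[of "\<bar>Y \<omega>\<bar>" "\<bar>Z \<omega>\<bar>"]
      by (simp add: abs_mult del: mult_nonneg_nonneg)
  qed
qed measurable

lemma (in prob_space) covariance_eq:
  fixes Y Z :: "'a \<Rightarrow> real"
  assumes "integrable M Y" "integrable M Z" "integrable M (\<lambda>\<omega>. Y \<omega> * Z \<omega>)"
  shows "covariance M Y Z = expectation (\<lambda>\<omega>. Y \<omega> * Z \<omega>) - expectation Y * expectation Z"
  using assms by (simp add: covariance_def left_diff_distrib right_diff_distrib prob_space)

context transported_variable
begin

text \<open>Equality of laws gives \<open>W\<close> and \<open>Z\<close> the same mean and variance,
  so both correlations have the same denominator and the numerators differ by E[Y(W - Z)].\<close>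

lemma pearson_correlation_le:
  assumes Y2: "integrable M (\<lambda>\<omega>. (Y \<omega>)\<^sup>2)" and Z2: "integrable M (\<lambda>\<omega>. (Z \<omega>)\<^sup>2)"
  shows "pearson_correlation M Y Z \<le> pearson_correlation M Y W"
proof -
  have W2: "integrable M (\<lambda>\<omega>. (W \<omega>)\<^sup>2)" using integrable_W[of "\<lambda>x. x\<^sup>2"] Z2 by simp
  note int = HF.square_integrable_imp_integrable[OF HF.Y Y2]
    HF.square_integrable_imp_integrable[OF LF.Y Z2]
    HF.square_integrable_imp_integrable[OF W_measurable W2]
  note YZ = HF.integrable_mult_of_square[OF HF.Y LF.Y Y2 Z2]
  note YW = HF.integrable_mult_of_square[OF HF.Y W_measurable Y2 W2]
  have EW: "HF.expectation W = HF.expectation Z" using integral_W[of "\<lambda>x. x"] by simp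
  have var: "HF.variance W = HF.variance Z"
    unfolding EW by (rule integral_W[of "\<lambda>x. (x - HF.expectation Z)\<^sup>2"]) measurable
  \<comment> \<open>The layer-cake lemma is applied with D = W - Z, whose mean is zero and whose
    tail integrals are nonnegative by \<open>tail_nonneg\<close>.\<close>
  have "0 \<le> (\<integral>\<omega>. Y \<omega> * (W \<omega> - Z \<omega>) \<partial>M)"
    using int YZ YW EW
    by (intro expectation_mult_nonneg[OF HF.prob_space_axioms HF.Y _ _ _ tail_nonneg])
      (simp_all add: right_diff_distrib)
  then have "HF.expectation (\<lambda>\<omega>. Y \<omega> * Z \<omega>) \<le> HF.expectation (\<lambda>\<omega>. Y \<omega> * W \<omega>)"
    using YZ YW by (simp add: right_diff_distrib)
  then have "covariance M Y Z \<le> covariance M Y W"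
    using int YZ YW by (simp add: HF.covariance_eq EW)
  \<comment> \<open>The common denominator is a square root, hence nonnegative, which suffices for
    monotonicity of division.\<close>
  then show ?thesis
    unfolding pearson_correlation_def var by (intro divide_right_mono) auto
qed

end

theorem theorem3p3:
  fixes \<mu> :: "(real ^ 'd) measure"
    and M :: "'a measure"
    and X :: "'a \<Rightarrow> real ^ 'd"
    and Q_HF Q_LF Q_mod :: "real ^ 'd \<Rightarrow> real"
    and F_HF F_LF :: "real \<Rightarrow> real"
    and c \<rho> \<rho>_mod :: real
  assumes "CARD('d) > 1"
    and "prob_space \<mu>" and "sets \<mu> = sets borel"
    and "prob_space M" and "X \<in> borel_measurable M" and "distr M borel X = \<mu>"
    and "Q_HF \<in> borel_measurable borel" and "Q_LF \<in> borel_measurable borel"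
    and "integrable M (\<lambda>\<omega>. (Q_HF (X \<omega>))\<^sup>2)"
    and "integrable M (\<lambda>\<omega>. (Q_LF (X \<omega>))\<^sup>2)"
    and "F_HF = cdf (distr M borel (\<lambda>\<omega>. Q_HF (X \<omega>)))"
    and "F_LF = cdf (distr M borel (\<lambda>\<omega>. Q_LF (X \<omega>)))"
    and "invertible_cdf F_HF" and "invertible_cdf F_LF"
    and "Q_mod = modified_model c F_HF F_LF Q_HF"
    and "\<rho> = pearson_correlation M (\<lambda>\<omega>. Q_HF (X \<omega>)) (\<lambda>\<omega>. Q_LF (X \<omega>))"
    and "\<rho>_mod = pearson_correlation M (\<lambda>\<omega>. Q_HF (X \<omega>)) (\<lambda>\<omega>. Q_mod (X \<omega>))"
  shows "\<rho>_mod \<ge> \<rho>"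
proof -
  interpret prob_space M by fact
  have meas: "(\<lambda>\<omega>. Q_HF (X \<omega>)) \<in> borel_measurable M" "(\<lambda>\<omega>. Q_LF (X \<omega>)) \<in> borel_measurable M"
    using assms by measurable
  \<comment> \<open>Composing with \<open>X\<close> moves everything to the sample space
    \<open>M\<close>; there \<open>modified_model\<close> unfolds to the formula for
    \<open>W\<close>.\<close>
  interpret transported_variable M "\<lambda>\<omega>. Q_HF (X \<omega>)" "\<lambda>\<omega>. Q_LF (X \<omega>)" F_HF F_LF
    "\<lambda>\<omega>. Q_mod (X \<omega>)" c
    by unfold_locales (use assms meas in \<open>auto simp: modified_model_def\<close>)
  show ?thesis
    using pearson_correlation_le assms by simp
qed

end
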